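(* Let $a>0$ and $n\ge 0$. If $\theta>0$, then $p_n^a(\theta)=p_n^{1/a}(1/\theta)$. If $\theta<0$, then $p_n^a(\theta)=p_n^a(1/\theta)$.
   Context: For $a\in(-1,\infty)$ and $\theta\in\mathbb R$, let $X_1,X_2,\ldots$ be i.i.d. random variables uniformly distributed on $[-a,1]$. Set $p_0^a(\theta):=1$ and, for $n\ge1$, $$p_n^a(\theta):=\mathbb P(X_2\ge\theta X_1,\,X_3\ge\theta X_2,\,\ldots,\,X_{n+1}\ge\theta X_n).$$ *)

theory Defs
  imports "HOL-Probability.Probability"
begin

text \<open>
  The joint law of i.i.d. random variables \<open>X\<^sub>1, X\<^sub>2, \<dots>\<close> that are uniformly distributed on \<open>[-a, 1]\<close>,
  realised on the infinite product space; \<open>X\<^sub>i\<close> is the \<open>i\<close>-th coordinate. This is meaningful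
  for \<open>a > -1\<close>.
\<close>

definition iid_uniform :: "real \<Rightarrow> (nat \<Rightarrow> real) measure" where
  "iid_uniform a = (\<Pi>\<^sub>M i\<in>{1..}. uniform_measure lborel {-a..1})"

definition p :: "nat \<Rightarrow> real \<Rightarrow> real \<Rightarrow> real" where
  "p n a \<theta> = (if n = 0 then 1 else
     measure (iid_uniform a) {X \<in> space (iid_uniform a). \<forall>i\<in>{1..n}. X (i + 1) \<ge> \<theta> * X i})"

text \<open>
  The definition does not depend on the chosen realisation: every i.i.d. sequence of uniform
  random variables on \<open>[-a, 1]\<close>, on any probability space, gives the same probabilities.
\<close>

lemma (in prob_space) prob_chain_eq_p:
  fixes X :: "nat \<Rightarrow> 'a \<Rightarrow> real"
  assumes indep: "indep_vars (\<lambda>_. borel) X {1..}"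
    and unif: "\<And>i. i \<ge> 1 \<Longrightarrow> distr M borel (X i) = uniform_measure lborel {-a..1}"
  shows "prob {\<omega> \<in> space M. \<forall>i\<in>{1..n}. X (i + 1) \<omega> \<ge> \<theta> * X i \<omega>} = p n a \<theta>"
proof (cases "n = 0")
  case True
  then show ?thesis by (simp add: p_def prob_space)
next
  case False
  let ?B = "\<Pi>\<^sub>M i\<in>{1..}. (borel :: real measure)"
  let ?F = "\<lambda>\<omega>. \<lambda>i\<in>{1..}. X i \<omega>"
  let ?E = "{x \<in> space ?B. \<forall>i\<in>{1..n}. x (i + 1) \<ge> \<theta> * x i}"
  have rv: "random_variable borel (X i)" if "i \<in> {1..}" for i
    using indep that by (auto simp: indep_vars_def)
  have F: "random_variable ?B ?F"
    by (intro measurable_restrict rv)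
  have "distr M ?B ?F = (\<Pi>\<^sub>M i\<in>{1..}. distr M borel (X i))"
    using indep by (subst (asm) indep_vars_iff_distr_eq_PiM') (auto intro: rv)
  also have "\<dots> = iid_uniform a"
    unfolding iid_uniform_def by (intro PiM_cong) (auto simp: unif)
  finally have D: "distr M ?B ?F = iid_uniform a" .
  have comp: "(\<lambda>x. x i) \<in> borel_measurable ?B" if "i \<ge> 1" for i
    using that by (intro measurable_component_singleton) auto
  have E: "?E \<in> sets ?B"
    by (intro sets.sets_Collect_finite_All' borel_measurable_le borel_measurable_times
        borel_measurable_const comp) (use False in auto)
  have "p n a \<theta> = measure (distr M ?B ?F) ?E"
    using False by (simp add: p_def flip: D)
  also have "\<dots> = prob (?F -` ?E \<inter> space M)"
    by (rule measure_distr[OF F E])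
  also have "?F -` ?E \<inter> space M = {\<omega> \<in> space M. \<forall>i\<in>{1..n}. X (i + 1) \<omega> \<ge> \<theta> * X i \<omega>}"
    using measurable_space[OF F] by auto
  finally show ?thesis by simp
qed

end

theory Submission
  imports Defs
begin

text \<open>
  Reversing the order of the first \<open>n + 1\<close> variables turns the chain of conditions
  \<open>X\<^sub>i\<^sub>+\<^sub>1 \<ge> \<theta> X\<^sub>i\<close> into \<open>X\<^sub>i \<ge> \<theta> X\<^sub>i\<^sub>+\<^sub>1\<close>. For \<open>\<theta> < 0\<close>, division by \<open>\<theta>\<close>
  reverses the inequality, so this is the chain for \<open>1 / \<theta>\<close>. For \<open>\<theta> > 0\<close> division keeps the
  inequality, and a change of sign is needed as well: the variables \<open>-X\<^sub>i / a\<close> are i.i.d. and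
  uniform on \<open>[-1 / a, 1]\<close>, and they satisfy the chain for \<open>1 / \<theta>\<close> in reversed order. Hence
  the theorem follows from the invariance of an i.i.d. sequence under permutation of the
  indices, combined with the scaling behaviour of uniform distributions.
\<close>

lemma distr_uniform_measure_scale:
  fixes c :: real
  assumes c: "c \<noteq> 0" and [measurable]: "S \<in> sets borel" "T \<in> sets borel"
    and ST: "\<And>x. c * x \<in> T \<longleftrightarrow> x \<in> S"
  shows "distr (uniform_measure lborel S) borel (\<lambda>x. c * x) = uniform_measure lborel T"
proof (rule measure_eqI)
  fix A assume "A \<in> sets (distr (uniform_measure lborel S) borel (\<lambda>x. c * x))"
  then have A[measurable]: "A \<in> sets borel" by simp
  have scale: "emeasure lborel B = ennreal \<bar>c\<bar> * emeasure lborel ((\<lambda>x. c * x) -` B)"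
    if [measurable]: "B \<in> sets borel" for B
  proof -
    have "emeasure lborel B = (\<integral>\<^sup>+x. indicator B x \<partial>lborel)"
      by simp
    also have "\<dots> = ennreal \<bar>c\<bar> * (\<integral>\<^sup>+x. indicator B (0 + c * x) \<partial>lborel)"
      by (rule nn_integral_real_affine) (use c in simp_all)
    also have "(\<integral>\<^sup>+x. indicator B (0 + c * x) \<partial>lborel)
        = (\<integral>\<^sup>+x. indicator ((\<lambda>x. c * x) -` B) x \<partial>lborel)"
      by (intro nn_integral_cong) (simp add: indicator_def)
    also have "\<dots> = emeasure lborel ((\<lambda>x. c * x) -` B)"
      by (intro nn_integral_indicator) (simp add: measurable_sets_borel[OF _ that])
    finally show ?thesis .
  qed
  have vim: "(\<lambda>x. c * x) -` T = S" "(\<lambda>x. c * x) -` (T \<inter> A) = S \<inter> (\<lambda>x. c * x) -` A"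
    using ST by auto
  have mv: "(\<lambda>x. c * x) -` A \<in> sets borel"
    by (rule measurable_sets_borel[OF _ A]) simp
  have "emeasure (distr (uniform_measure lborel S) borel (\<lambda>x. c * x)) A
      = emeasure lborel (S \<inter> (\<lambda>x. c * x) -` A) / emeasure lborel S"
    using mv by (simp add: emeasure_distr)
  also have "\<dots> = (ennreal \<bar>c\<bar> * emeasure lborel (S \<inter> (\<lambda>x. c * x) -` A))
      / (ennreal \<bar>c\<bar> * emeasure lborel S)"
    using c by (subst (1 2) mult.commute[of "ennreal \<bar>c\<bar>"], subst divide_mult_eq) simp_all
  also have "\<dots> = emeasure lborel (T \<inter> A) / emeasure lborel T"
    by (simp add: scale[of T] scale[of "T \<inter> A"] vim)
  also have "\<dots> = emeasure (uniform_measure lborel T) A"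
    by simp
  finally show "emeasure (distr (uniform_measure lborel S) borel (\<lambda>x. c * x)) A
      = emeasure (uniform_measure lborel T) A" .
qed simp

text \<open>
  Selecting distinct coordinates of an i.i.d. family and applying one measurable map to each
  of them yields an independent family. Injectivity of \<open>\<sigma>\<close> ensures that no coordinate
  is used twice.
\<close>

lemma indep_vars_PiM_reindex:
  assumes P: "prob_space P" and f: "f \<in> measurable P N"
    and inj: "inj_on \<sigma> J" and sub: "\<sigma> ` J \<subseteq> I" and J: "J \<noteq> {}"
  shows "prob_space.indep_vars (\<Pi>\<^sub>M i\<in>I. P) (\<lambda>_. N) (\<lambda>i x. f (x (\<sigma> i))) J"
proof -
  interpret prob_space "\<Pi>\<^sub>M i\<in>I. P"
    by (intro prob_space_PiM P)
  have rv: "random_variable P (\<lambda>x. x (\<sigma> i))" if "i \<in> J" for i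
    using that sub by (intro measurable_component_singleton) auto
  have "distr (\<Pi>\<^sub>M i\<in>I. P) (\<Pi>\<^sub>M i\<in>J. P) (\<lambda>x. \<lambda>i\<in>J. x (\<sigma> i)) = (\<Pi>\<^sub>M i\<in>J. P)"
    using distr_PiM_reindex[of I "\<lambda>_. P" \<sigma> J] P inj sub by auto
  also have "\<dots> = (\<Pi>\<^sub>M i\<in>J. distr (\<Pi>\<^sub>M i\<in>I. P) P (\<lambda>x. x (\<sigma> i)))"
    using sub P by (intro PiM_cong refl) (subst distr_PiM_component, auto)
  finally have "indep_vars (\<lambda>_. P) (\<lambda>i x. x (\<sigma> i)) J"
    using J rv by (subst indep_vars_iff_distr_eq_PiM') auto
  then show ?thesis
    by (rule indep_vars_compose2) (use f in auto)
qed

text \<open>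
  The event on the right is the chain event of the variables \<open>c X\<^sub>n\<^sub>+\<^sub>1, \<dots>, c X\<^sub>1\<close>,
  which are again i.i.d. and uniform, now on \<open>[-b, 1]\<close>.
  The reversal \<open>i \<mapsto> n + 2 - i\<close> is extended by the identity beyond \<open>n + 1\<close>
  to obtain an injective map on all positive indices.
\<close>

lemma p_reversed_scaled:
  fixes a b c :: real
  assumes a: "a > -1" and c: "c \<noteq> 0"
    and range: "\<And>x. c * x \<in> {-b..1} \<longleftrightarrow> x \<in> {-a..1}"
  shows "p n b \<theta> = measure (iid_uniform a)
    {X \<in> space (iid_uniform a). \<forall>i\<in>{1..n}. c * X i \<ge> \<theta> * (c * X (i + 1))}"
proof -
  define U where "U = uniform_measure lborel {-a..1}"
  define \<sigma> where "\<sigma> i = (if i \<le> n + 1 then n + 2 - i else i)" for i :: nat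
  have U: "prob_space U"
    unfolding U_def using a by (intro prob_space_uniform_measure) auto
  have M: "iid_uniform a = (\<Pi>\<^sub>M i\<in>{1..}. U)"
    by (simp add: iid_uniform_def U_def)
  interpret prob_space "iid_uniform a"
    unfolding M by (intro prob_space_PiM U)
  have f: "(\<lambda>x. c * x) \<in> borel_measurable U"
    by (simp add: U_def)
  have \<sigma>: "inj_on \<sigma> {1..}" "\<sigma> ` {1..} \<subseteq> {1..}"
    by (auto simp: inj_on_def \<sigma>_def split: if_splits)
  have indep: "indep_vars (\<lambda>_. borel) (\<lambda>i X. c * X (\<sigma> i)) {1..}"
    unfolding M by (intro indep_vars_PiM_reindex U f \<sigma>) auto
  have unif: "distr (iid_uniform a) borel (\<lambda>X. c * X (\<sigma> i)) = uniform_measure lborel {-b..1}"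
    if "i \<ge> 1" for i
  proof -
    have i: "\<sigma> i \<in> {1..}"
      using \<sigma>(2) that by auto
    have "distr (iid_uniform a) borel (\<lambda>X. c * X (\<sigma> i))
        = distr (distr (iid_uniform a) U (\<lambda>X. X (\<sigma> i))) borel (\<lambda>x. c * x)"
      unfolding M using i f by (subst distr_distr) (auto simp: comp_def)
    also have "distr (iid_uniform a) U (\<lambda>X. X (\<sigma> i)) = U"
      unfolding M using U i by (intro distr_PiM_component) auto
    also have "distr U borel (\<lambda>x. c * x) = uniform_measure lborel {-b..1}"
      unfolding U_def using c range by (intro distr_uniform_measure_scale) auto
    finally show ?thesis .
  qed
  have chain: "(\<forall>i\<in>{1..n}. c * X (\<sigma> (i + 1)) \<ge> \<theta> * (c * X (\<sigma> i)))
      \<longleftrightarrow> (\<forall>i\<in>{1..n}. c * X i \<ge> \<theta> * (c * X (i + 1)))" for X :: "nat \<Rightarrow> real"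
  proof -
    have "(\<forall>i\<in>{1..n}. c * X (\<sigma> (i + 1)) \<ge> \<theta> * (c * X (\<sigma> i)))
        \<longleftrightarrow> (\<forall>i\<in>{1..n}. c * X (n + 1 - i) \<ge> \<theta> * (c * X (n + 1 - i + 1)))"
      by (intro ball_cong refl) (auto simp: \<sigma>_def Suc_diff_le)
    also have "\<dots> \<longleftrightarrow> (\<forall>i\<in>(\<lambda>i. n + 1 - i) ` {1..n}. c * X i \<ge> \<theta> * (c * X (i + 1)))"
      by blast
    also have "(\<lambda>i. n + 1 - i) ` {1..n} = {1..n}"
      by (intro bij_betw_imp_surj_on bij_betw_byWitness[where f' = "\<lambda>i. n + 1 - i"]) auto
    finally show ?thesis .
  qed
  show ?thesis
    using prob_chain_eq_p[OF indep unif, of n \<theta>] by (simp only: chain)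
qed

theorem lemma1:
  fixes a \<theta> :: real and n :: nat
  assumes "a > 0"
  shows "(\<theta> > 0 \<longrightarrow> p n a \<theta> = p n (1 / a) (1 / \<theta>)) \<and>
         (\<theta> < 0 \<longrightarrow> p n a \<theta> = p n a (1 / \<theta>))"
proof (intro conjI impI)
  \<comment> \<open>For \<open>n = 0\<close> the chain is empty, so its probability agrees with the separate value \<open>1\<close>.\<close>
  have p_eq: "p n a \<theta> = measure (iid_uniform a)
      {X \<in> space (iid_uniform a). \<forall>i\<in>{1..n}. X (i + 1) \<ge> \<theta> * X i}"
  proof -
    interpret prob_space "iid_uniform a"
      unfolding iid_uniform_def using assms
      by (intro prob_space_PiM prob_space_uniform_measure) auto
    show ?thesis
      by (simp add: p_def prob_space)
  qed
  {
    assume \<theta>: "\<theta> > 0"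
    have "p n (1 / a) (1 / \<theta>) = measure (iid_uniform a)
        {X \<in> space (iid_uniform a). \<forall>i\<in>{1..n}. - 1 / a * X i \<ge> 1 / \<theta> * (- 1 / a * X (i + 1))}"
      using assms by (intro p_reversed_scaled) (auto simp: field_simps)
    also have "\<dots> = p n a \<theta>"
      unfolding p_eq using assms \<theta>
      by (intro arg_cong[where f = "measure _"] Collect_cong conj_cong ball_cong refl)
        (simp add: field_simps)
    finally show "p n a \<theta> = p n (1 / a) (1 / \<theta>)" ..
  next
    assume \<theta>: "\<theta> < 0"
    have "p n a (1 / \<theta>) = measure (iid_uniform a)
        {X \<in> space (iid_uniform a). \<forall>i\<in>{1..n}. 1 * X i \<ge> 1 / \<theta> * (1 * X (i + 1))}"
      using assms by (intro p_reversed_scaled) auto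
    also have "\<dots> = p n a \<theta>"
      unfolding p_eq using \<theta>
      by (intro arg_cong[where f = "measure _"] Collect_cong conj_cong ball_cong refl)
        (simp add: field_simps)
    finally show "p n a \<theta> = p n a (1 / \<theta>)" ..
  }
qed

end
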